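(* Let $L>0$, $f\in\mathcal F_L(\mathbb R^n)$, $x_0\in\mathbb R^n$, and let $(x^{(k)})_{k\in\mathbb N}$ be the trajectory of the accelerated gradient method (defined in the context) with initial point $x_0$ and parameters $(A_k)_{k\in\mathbb N}$ satisfying the step-size condition stated there. Then for any $w\in\mathbb R^n$ and $k\ge1$, $$g(x^{(k)})\le g(w)+\frac{2\|w-x_0\|^2}{A_k}.$$ In particular, $\lim_{k\to\infty}g(x^{(k)})=\inf_{x\in\mathbb R^n}g(x)$, including the case $\inf_{x\in\mathbb R^n}g(x)=-\infty$.
   Context: $\|\cdot\|$ and $\langle\cdot,\cdot\rangle$ are the Euclidean norm and inner product on $\mathbb R^n$. For $L>0$, $\mathcal F_L(\mathbb R^n)$ is the set of finite-valued differentiable convex functions $f:\mathbb R^n\to\mathbb R$ whose gradient is $L$-Lipschitz. The Legendre--Fenchel conjugate is $f^*(p):=\sup_{x\in\mathbb R^n}\{\langle p,x\rangle-f(x)\}$, and $\operatorname{dom} f^*:=\{p: f^*(p)<\infty\}$, a nonempty convex set. $p^\star$ denotes the (unique) minimum-norm point of the closure $\overline{\operatorname{dom} f^*}$, and $g(x):=f(x)-\langle p^\star,x\rangle$. Accelerated gradient method: let $(A_k)_{k\in\mathbb N}$ be real numbers with $\delta^+A_k:=A_{k+1}-A_k$ satisfying the step-size condition $$A_0=0,\qquad 0<\delta^+A_k\le 2\sqrt{A_{k+1}/L}\ \ (\forall k\in\mathbb N),\qquad \delta^+A_k=\Theta(k)\ (k\to\infty).$$ Set $x^{(0)}:=y^{(0)}:=x_0$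 and, for $k\in\mathbb N$, $$x^{(k+1)}:=y^{(k)}-\frac{(\delta^+A_k)^2}{4A_{k+1}}\nabla f(y^{(k)}),\qquad y^{(k+1)}:=x^{(k+1)}+\frac{A_k\,\delta^+A_{k+1}}{A_{k+2}\,\delta^+A_k}\,(x^{(k+1)}-x^{(k)}).$$ *)

theory Defs
  imports "HOL-Analysis.Analysis" "HOL-Library.Landau_Symbols"
begin

definition gradient :: "(real^'n \<Rightarrow> real) \<Rightarrow> real^'n \<Rightarrow> real^'n" where
  "gradient f x = (THE d. GDERIV f x :> d)"

definition smooth_convex :: "real \<Rightarrow> (real^'n \<Rightarrow> real) set" where
  "smooth_convex L =
     {f. convex_on UNIV f \<and> (\<forall>x. f differentiable (at x)) \<and> L-lipschitz_on UNIV (gradient f)}"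

definition fenchel_conjugate :: "(real^'n \<Rightarrow> real) \<Rightarrow> real^'n \<Rightarrow> ereal" where
  "fenchel_conjugate f p = (SUP x. ereal (p \<bullet> x - f x))"

definition conjugate_dom :: "(real^'n \<Rightarrow> real) \<Rightarrow> (real^'n) set" where
  "conjugate_dom f = {p. fenchel_conjugate f p < \<infinity>}"

text \<open>The point of the closure nearest to the origin, i.e. its point of minimum norm. For
  convex \<^term>\<open>f\<close> the domain is nonempty and convex, so this point exists and is unique.\<close>

definition min_slope :: "(real^'n \<Rightarrow> real) \<Rightarrow> real^'n" where
  "min_slope f = closest_point (closure (conjugate_dom f)) 0"

definition tilted :: "(real^'n \<Rightarrow> real) \<Rightarrow> real^'n \<Rightarrow> real" where
  "tilted f x = f x - min_slope f \<bullet> x"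

definition fdiff :: "(nat \<Rightarrow> real) \<Rightarrow> nat \<Rightarrow> real" where
  "fdiff A k = A (Suc k) - A k"

definition step_size_condition :: "real \<Rightarrow> (nat \<Rightarrow> real) \<Rightarrow> bool" where
  "step_size_condition L A \<longleftrightarrow>
     A 0 = 0 \<and>
     (\<forall>k. 0 < fdiff A k \<and> fdiff A k \<le> 2 * sqrt (A (Suc k) / L)) \<and>
     fdiff A \<in> \<Theta>(\<lambda>k. real k)"

text \<open>The recursion runs on the pair consisting of the iterate and the extrapolated point.\<close>

primrec agm :: "(real^'n \<Rightarrow> real) \<Rightarrow> (nat \<Rightarrow> real) \<Rightarrow> real^'n \<Rightarrow> nat \<Rightarrow> (real^'n) \<times> (real^'n)" where
  "agm f A x0 0 = (x0, x0)"
| "agm f A x0 (Suc k) =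
     (let x = fst (agm f A x0 k);
          y = snd (agm f A x0 k);
          x' = y - ((fdiff A k)\<^sup>2 / (4 * A (k + 1))) *\<^sub>R gradient f y
      in (x', x' + ((A k * fdiff A (k + 1)) / (A (k + 2) * fdiff A k)) *\<^sub>R (x' - x)))"

definition agm_iterate ::
    "(real^'n \<Rightarrow> real) \<Rightarrow> (nat \<Rightarrow> real) \<Rightarrow> real^'n \<Rightarrow> nat \<Rightarrow> real^'n" where
  "agm_iterate f A x0 k = fst (agm f A x0 k)"

end

theory Submission
  imports Defs
begin

text \<open>
  Put \<open>p = p\<^sup>\<star>\<close>. The method is driven by \<open>\<nabla>f = \<nabla>g + p\<close>, so the iterates are those of an accelerated
  method for \<open>g\<close> with an extra drift along \<open>-p\<close>. As gradients of \<open>f\<close> lie in the domain of \<open>f\<^sup>*\<close>,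
  minimality of \<open>p\<close> gives \<open>\<langle>p, \<nabla>g\<rangle> \<ge> 0\<close>, i.e. \<open>g\<close> does not increase along \<open>-p\<close>. Hence the drift does
  no harm in the descent step, and in the usual Lyapunov function it is compensated by letting the
  comparison point move as \<open>w - (A\<^sub>k/4) p\<close>: with \<open>A\<^sub>k\<^sub>+\<^sub>1 y\<^sub>k = A\<^sub>k x\<^sub>k + (\<delta>\<^sup>+A\<^sub>k) z\<^sub>k\<close>, the quantity
  \<open>A\<^sub>k (g(x\<^sub>k) - g(w)) + 2 \<parallel>z\<^sub>k - w + (A\<^sub>k/4) p\<parallel>\<^sup>2\<close> is nonincreasing in \<open>k\<close>.
\<close>

section \<open>Gradients, tangents and quadratic upper bounds\<close>

text \<open>The derivative is represented by the Riesz vector \<open>adjoint f' 1\<close>, and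
  uniqueness of derivatives makes the definite description in \<open>gradient\<close> well
  defined.\<close>

lemma gderiv_gradient:
  assumes "f differentiable (at x)"
  shows "GDERIV f x :> gradient f x"
proof -
  obtain f' where f': "(f has_derivative f') (at x)"
    using assms by (auto simp: differentiable_def)
  have "f' = (\<lambda>h. h \<bullet> adjoint f' 1)"
    using adjoint_works[OF has_derivative_linear[OF f'], of _ 1] by (simp add: fun_eq_iff)
  then have ex: "GDERIV f x :> adjoint f' 1"
    using f' by (simp add: gderiv_def)
  have "d = adjoint f' 1" if "GDERIV f x :> d" for d
    using has_derivative_unique[OF that[unfolded gderiv_def] ex[unfolded gderiv_def]]
    by (simp add: fun_eq_iff vector_eq_ldot)
  with ex show ?thesis
    unfolding gradient_def by (rule theI)
qed

lemma gderiv_line: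
  fixes f :: "'a::real_inner \<Rightarrow> real"
  assumes "GDERIV f (x + t *\<^sub>R h) :> d"
  shows "((\<lambda>t. f (x + t *\<^sub>R h)) has_real_derivative d \<bullet> h) (at t)"
proof -
  have "((\<lambda>t. x + t *\<^sub>R h) has_derivative (\<lambda>s. s *\<^sub>R h)) (at t)"
    by (auto intro!: derivative_eq_intros)
  from has_derivative_compose[OF this assms[unfolded gderiv_def]]
  show ?thesis
    by (rule has_derivative_imp_has_field_derivative) (simp add: inner_commute)
qed

text \<open>Restricting to the line through \<open>a\<close> and \<open>b\<close> reduces this to
  the tangent inequality for convex functions of one real variable.\<close>

lemma convex_above_tangent_gderiv:
  fixes f :: "'a::real_inner \<Rightarrow> real"
  assumes "convex_on UNIV f" "GDERIV f a :> d"
  shows "f a + d \<bullet> (b - a) \<le> f b"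
proof -
  let ?h = "\<lambda>t. f (a + t *\<^sub>R (b - a))"
  have "convex_on UNIV ?h"
  proof (rule convex_onI)
    fix t x y :: real assume t: "0 < t" "t < 1"
    have eq: "a + ((1 - t) *\<^sub>R x + t *\<^sub>R y) *\<^sub>R (b - a)
        = (1 - t) *\<^sub>R (a + x *\<^sub>R (b - a)) + t *\<^sub>R (a + y *\<^sub>R (b - a))"
      by (simp add: algebra_simps)
    show "?h ((1 - t) *\<^sub>R x + t *\<^sub>R y) \<le> (1 - t) * ?h x + t * ?h y"
      unfolding eq using t by (intro convex_onD[OF assms(1)]) auto
  qed simp
  moreover have "(?h has_real_derivative d \<bullet> (b - a)) (at 0)"
    by (rule gderiv_line) (simp add: assms(2))
  ultimately have "?h 1 - ?h 0 \<ge> d \<bullet> (b - a) * (1 - 0)"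
    by (intro convex_on_imp_above_tangent[where A = UNIV]) auto
  then show ?thesis by simp
qed

lemma lipschitz_gradient_upper_bound:
  fixes f :: "'a::real_inner \<Rightarrow> real"
  assumes D: "\<And>x. GDERIV f x :> G x" and lip: "L-lipschitz_on UNIV G"
  shows "f (x + h) \<le> f x + G x \<bullet> h + L / 2 * (norm h)\<^sup>2"
proof -
  \<comment> \<open>The claim is \<open>r 1 \<le> r 0\<close>; Cauchy-Schwarz and the Lipschitz
    bound make the derivative of \<open>r\<close> nonpositive on [0, 1].\<close>
  define r where "r t = f (x + t *\<^sub>R h) - t * (G x \<bullet> h) - L / 2 * t\<^sup>2 * (norm h)\<^sup>2" for t
  have "r 1 \<le> r 0"
  proof (rule DERIV_nonpos_imp_nonincreasing[where f = r])
    fix t :: real assume t: "0 \<le> t" "t \<le> 1"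
    let ?d = "G (x + t *\<^sub>R h) \<bullet> h - G x \<bullet> h - L * t * (norm h)\<^sup>2"
    have "(r has_real_derivative ?d) (at t)"
      unfolding r_def by (auto intro!: derivative_eq_intros gderiv_line D)
    moreover have "?d \<le> 0"
    proof -
      have "G (x + t *\<^sub>R h) \<bullet> h - G x \<bullet> h \<le> norm (G (x + t *\<^sub>R h) - G x) * norm h"
        by (metis inner_diff_left norm_cauchy_schwarz)
      also have "\<dots> \<le> (L * norm (t *\<^sub>R h)) * norm h"
        using lipschitz_onD[OF lip, of "x + t *\<^sub>R h" x]
        by (intro mult_right_mono) (auto simp: dist_norm)
      also have "\<dots> = L * t * (norm h)\<^sup>2"
        using t by (simp add: power2_eq_square)
      finally show ?thesis by simp
    qed
    ultimately show "\<exists>y. (r has_real_derivative y) (at t) \<and> y \<le> 0" by blast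
  qed simp
  then show ?thesis by (simp add: r_def)
qed

section \<open>The conjugate domain and its minimum-norm slope\<close>

lemma mem_conjugate_dom_iff:
  "p \<in> conjugate_dom f \<longleftrightarrow> (\<exists>B. \<forall>x. p \<bullet> x - f x \<le> B)"
proof
  assume "p \<in> conjugate_dom f"
  then have fin: "fenchel_conjugate f p < \<infinity>" by (simp add: conjugate_dom_def)
  have le: "ereal (p \<bullet> x - f x) \<le> fenchel_conjugate f p" for x
    unfolding fenchel_conjugate_def by (rule SUP_upper) simp
  \<comment> \<open>The value minus infinity is excluded by \<open>le\<close>, since every
    \<open>p \<bullet> x - f x\<close> is real.\<close>
  show "\<exists>B. \<forall>x. p \<bullet> x - f x \<le> B"
    using le fin by (cases "fenchel_conjugate f p") auto
next
  assume "\<exists>B. \<forall>x. p \<bullet> x - f x \<le> B"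
  then obtain B where "p \<bullet> x - f x \<le> B" for x by blast
  then have "fenchel_conjugate f p \<le> ereal B"
    unfolding fenchel_conjugate_def by (intro SUP_least) auto
  then show "p \<in> conjugate_dom f"
    by (auto simp: conjugate_dom_def intro: le_less_trans)
qed

lemma convex_conjugate_dom: "convex (conjugate_dom f)"
proof (rule convexI)
  fix p q and u v :: real
  assume "p \<in> conjugate_dom f" "q \<in> conjugate_dom f" and uv: "0 \<le> u" "0 \<le> v" "u + v = 1"
  then obtain B C where B: "\<And>x. p \<bullet> x - f x \<le> B" and C: "\<And>x. q \<bullet> x - f x \<le> C"
    unfolding mem_conjugate_dom_iff by blast
  have "(u *\<^sub>R p + v *\<^sub>R q) \<bullet> x - f x \<le> u * B + v * C" for x
  proof -
    have "(u *\<^sub>R p + v *\<^sub>R q) \<bullet> x - f x = u * (p \<bullet> x) + v * (q \<bullet> x) - (u + v) * f x"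
      using uv by (simp add: inner_add_left)
    also have "\<dots> = u * (p \<bullet> x - f x) + v * (q \<bullet> x - f x)"
      by (simp add: algebra_simps)
    also have "\<dots> \<le> u * B + v * C"
      using uv B C by (intro add_mono mult_left_mono) auto
    finally show ?thesis .
  qed
  then show "u *\<^sub>R p + v *\<^sub>R q \<in> conjugate_dom f"
    unfolding mem_conjugate_dom_iff by blast
qed

text \<open>This is the obtuse-angle criterion for the projection of 0 onto the closed convex set
  \<open>closure (conjugate_dom f)\<close>.\<close>

lemma min_slope_inner_nonneg:
  assumes "q \<in> conjugate_dom f"
  shows "0 \<le> min_slope f \<bullet> (q - min_slope f)"
proof -
  have "(0 - min_slope f) \<bullet> (q - min_slope f) \<le> 0"
    unfolding min_slope_def
    using assms closure_subset by (intro closest_point_dot convex_closure convex_conjugate_dom) auto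
  then show ?thesis by simp
qed

text \<open>The tangent is taken at the end point \<open>a - c *\<^sub>R p\<close>, where its slope
  towards \<open>a\<close> is nonnegative.\<close>

lemma nonincreasing_along_drift:
  fixes g :: "'a::real_inner \<Rightarrow> real"
  assumes tangent: "\<And>a b. g a + G a \<bullet> (b - a) \<le> g b"
    and "\<And>a. 0 \<le> p \<bullet> G a" and "0 \<le> c"
  shows "g (a - c *\<^sub>R p) \<le> g a"
proof -
  have "0 \<le> c * (p \<bullet> G (a - c *\<^sub>R p))"
    using assms by simp
  then show ?thesis
    using tangent[of "a - c *\<^sub>R p" a] by (simp add: inner_commute)
qed

section \<open>Energy decrease and growth of the parameters\<close>

text \<open>Here \<alpha> stands for \<open>A k\<close>, \<delta> for \<open>fdiff A k\<close>, and
  \<open>G y + p\<close> for the gradient of \<open>f\<close>. The gain from descent pays for the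
  squared gradient produced by the move of \<open>z\<close>, and convexity pays for the cross
  term.\<close>

lemma lyapunov_step:
  fixes g :: "'a::real_inner \<Rightarrow> real"
  assumes tangent: "\<And>a b. g a + G a \<bullet> (b - a) \<le> g b"
    and smooth: "\<And>a h. g (a + h) \<le> g a + G a \<bullet> h + L / 2 * (norm h)\<^sup>2"
    and drift: "\<And>a. 0 \<le> p \<bullet> G a"
    and pos: "0 \<le> \<alpha>" "0 < \<delta>" and step: "L * \<delta>\<^sup>2 / (4 * (\<alpha> + \<delta>)) \<le> 1"
    and y: "(\<alpha> + \<delta>) *\<^sub>R y = \<alpha> *\<^sub>R x + \<delta> *\<^sub>R z"
    and x': "x' = y - (\<delta>\<^sup>2 / (4 * (\<alpha> + \<delta>))) *\<^sub>R (G y + p)"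
    and z': "z' = z - (\<delta> / 4) *\<^sub>R (G y + p)"
  shows "(\<alpha> + \<delta>) * (g x' - g w) + 2 * (norm (z' - (w - ((\<alpha> + \<delta>) / 4) *\<^sub>R p)))\<^sup>2
    \<le> \<alpha> * (g x - g w) + 2 * (norm (z - (w - (\<alpha> / 4) *\<^sub>R p)))\<^sup>2"
proof -
  define s where "s = \<delta>\<^sup>2 / (4 * (\<alpha> + \<delta>))"
  define v where "v = w - (\<alpha> / 4) *\<^sub>R p"
  have s: "0 \<le> s" "L * s \<le> 1"
    using pos step by (auto simp: s_def)
  \<comment> \<open>The step splits into a gradient step for \<open>g\<close> and a drift along
    \<open>-p\<close>, which cannot increase \<open>g\<close>.\<close>
  have "x' = (y + - (s *\<^sub>R G y)) - s *\<^sub>R p"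
    by (simp add: x' s_def scaleR_add_right)
  then have "g x' \<le> g (y + - (s *\<^sub>R G y))"
    using nonincreasing_along_drift[OF tangent drift s(1)] by simp
  also have "\<dots> \<le> g y - s * (norm (G y))\<^sup>2 + L / 2 * (s\<^sup>2 * (norm (G y))\<^sup>2)"
    using smooth[of y "- (s *\<^sub>R G y)"] by (simp add: power_mult_distrib power2_norm_eq_inner)
  also have "L / 2 * (s\<^sup>2 * (norm (G y))\<^sup>2) = L * s * (s * (norm (G y))\<^sup>2 / 2)"
    by (simp add: power2_eq_square)
  also have "\<dots> \<le> 1 * (s * (norm (G y))\<^sup>2 / 2)"
    using s by (intro mult_right_mono) auto
  finally have "g x' \<le> g y - s / 2 * (norm (G y))\<^sup>2"
    by simp
  then have "(\<alpha> + \<delta>) * g x' \<le> (\<alpha> + \<delta>) * (g y - s / 2 * (norm (G y))\<^sup>2)"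
    using pos by (intro mult_left_mono) auto
  also have "\<dots> = (\<alpha> + \<delta>) * g y - ((\<alpha> + \<delta>) * s) / 2 * (norm (G y))\<^sup>2"
    by (simp add: right_diff_distrib)
  \<comment> \<open>This choice of \<open>s\<close> makes the gain exactly the quadratic term that
    appears in \<open>expand\<close>.\<close>
  also have "(\<alpha> + \<delta>) * s = \<delta>\<^sup>2 / 4"
    using pos by (simp add: s_def del: distrib_left_numeral)
  finally have descent: "(\<alpha> + \<delta>) * g x' \<le> (\<alpha> + \<delta>) * g y - \<delta>\<^sup>2 / 8 * (norm (G y))\<^sup>2"
    by simp
  \<comment> \<open>Convexity is applied at the moved comparison point \<open>v\<close>, the one in
    the energy; this inequality then returns to the fixed \<open>w\<close>.\<close>
  have "g v \<le> g w"
    unfolding v_def using pos by (intro nonincreasing_along_drift[OF tangent drift]) auto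
  then have "\<alpha> * (g y + G y \<bullet> (x - y)) + \<delta> * (g y + G y \<bullet> (v - y)) \<le> \<alpha> * g x + \<delta> * g w"
    using pos tangent[of y x] tangent[of y v] by (intro add_mono mult_left_mono) auto
  moreover have "\<alpha> * (G y \<bullet> (x - y)) + \<delta> * (G y \<bullet> (v - y)) = - \<delta> * (G y \<bullet> (z - v))"
    using arg_cong[OF y, of "\<lambda>u. G y \<bullet> u"] by (simp add: inner_simps algebra_simps)
  ultimately have conv: "(\<alpha> + \<delta>) * g y - \<delta> * (G y \<bullet> (z - v)) \<le> \<alpha> * g x + \<delta> * g w"
    by (simp add: algebra_simps)
  have expand: "2 * (norm (u - (\<delta> / 4) *\<^sub>R d))\<^sup>2
      = 2 * (norm u)\<^sup>2 - \<delta> * (d \<bullet> u) + \<delta>\<^sup>2 / 8 * (norm d)\<^sup>2" for u d :: 'a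
    unfolding power2_norm_eq_inner
    by (simp add: inner_diff inner_commute algebra_simps power2_eq_square)
  \<comment> \<open>The comparison point moves by the same multiple of \<open>p\<close> as
    \<open>z\<close>, so only the gradient of \<open>g\<close> remains.\<close>
  have "z' - (w - ((\<alpha> + \<delta>) / 4) *\<^sub>R p) = (z - v) - (\<delta> / 4) *\<^sub>R G y"
    by (simp add: z' v_def algebra_simps add_divide_distrib)
  then have "2 * (norm (z' - (w - ((\<alpha> + \<delta>) / 4) *\<^sub>R p)))\<^sup>2
      = 2 * (norm (z - v))\<^sup>2 - \<delta> * (G y \<bullet> (z - v)) + \<delta>\<^sup>2 / 8 * (norm (G y))\<^sup>2"
    by (simp only: expand)
  with descent conv show ?thesis
    by (simp add: algebra_simps v_def)
qed

text \<open>The increments eventually dominate \<open>c * real k\<close>, hence are at least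
  \<open>c\<close> from some index \<open>M \<ge> 1\<close> on, and a linear minorant already forces
  divergence.\<close>

lemma step_size_tendsto_at_top:
  assumes "step_size_condition L A"
  shows "filterlim A at_top sequentially"
proof -
  have pos: "\<And>k. 0 < fdiff A k" and "fdiff A \<in> \<Omega>(\<lambda>k. real k)"
    using assms by (auto simp: step_size_condition_def bigtheta_def)
  then obtain c where c: "c > 0" and ev: "eventually (\<lambda>k. norm (fdiff A k) \<ge> c * norm (real k)) at_top"
    by (auto elim: landau_omega.bigE)
  then obtain N where N: "\<And>k. k \<ge> N \<Longrightarrow> fdiff A k \<ge> c * real k"
    using pos by (auto simp: eventually_at_top_linorder abs_of_pos)
  define M where "M = max N 1"
  have inc: "A (Suc k) \<ge> A k + c" if "k \<ge> M" for k
  proof -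
    have "c * 1 \<le> c * real k" using c that by (intro mult_left_mono) (auto simp: M_def)
    with N[of k] that show ?thesis by (auto simp: fdiff_def M_def)
  qed
  have "(A M - c * real M) + c * real k \<le> A k" if "k \<ge> M" for k
    using that
  proof (induction k rule: dec_induct)
    case (step k)
    with inc[of k] show ?case by (simp add: algebra_simps)
  qed simp
  then have "eventually (\<lambda>k. (A M - c * real M) + c * real k \<le> A k) sequentially"
    by (rule eventually_sequentiallyI)
  moreover have "filterlim (\<lambda>k. (A M - c * real M) + c * real k) at_top sequentially"
    by (rule filterlim_tendsto_add_at_top[OF tendsto_const
          filterlim_tendsto_pos_mult_at_top[OF tendsto_const c filterlim_real_sequentially]])
  ultimately show ?thesis
    by (rule filterlim_at_top_mono[rotated])
qed

theorem theorem5p2: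
  fixes f :: "real^'n \<Rightarrow> real" and L :: real and A :: "nat \<Rightarrow> real" and x0 :: "real^'n"
  assumes "L > 0"
    and "f \<in> smooth_convex L"
    and "step_size_condition L A"
  shows "(\<forall>w. \<forall>k\<ge>1. tilted f (agm_iterate f A x0 k)
            \<le> tilted f w + 2 * (norm (w - x0))\<^sup>2 / A k) \<and>
         ((\<lambda>k. ereal (tilted f (agm_iterate f A x0 k))) \<longlonglongrightarrow> (INF x. ereal (tilted f x)))"
proof -
  define p where "p = min_slope f"
  define g where "g = tilted f"
  define G where "G a = gradient f a - p" for a
  define x where "x = agm_iterate f A x0"
  define y where "y k = snd (agm f A x0 k)" for k
  \<comment> \<open>The auxiliary sequence is obtained by solving the coupling relation
    \<open>yz\<close> for \<open>z k\<close>.\<close>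
  define z where "z k = x k + (A (Suc k) / fdiff A k) *\<^sub>R (y k - x k)" for k
  have cvx: "convex_on UNIV f" and D: "\<And>a. GDERIV f a :> gradient f a"
    and lip: "L-lipschitz_on UNIV (gradient f)"
    using assms(2) by (auto simp: smooth_convex_def gderiv_gradient)
  have g_eq: "g a = f a - p \<bullet> a" for a
    by (simp add: g_def tilted_def p_def)
  have f_tangent: "f a + gradient f a \<bullet> (b - a) \<le> f b" for a b
    by (rule convex_above_tangent_gderiv[OF cvx D])
  have tangent: "g a + G a \<bullet> (b - a) \<le> g b" for a b
    using f_tangent[of a b] by (simp add: g_eq G_def inner_simps)
  have smooth: "g (a + h) \<le> g a + G a \<bullet> h + L / 2 * (norm h)\<^sup>2" for a h
    using lipschitz_gradient_upper_bound[OF D lip, of a h] by (simp add: g_eq G_def inner_simps)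
  have drift: "0 \<le> p \<bullet> G a" for a
  proof -
    \<comment> \<open>By the tangent inequality, the supremum defining the conjugate at
      \<open>gradient f a\<close> is attained at \<open>a\<close>, so it is finite.\<close>
    have "gradient f a \<bullet> b - f b \<le> gradient f a \<bullet> a - f a" for b
      using f_tangent[of a b] by (simp add: inner_simps)
    then have "gradient f a \<in> conjugate_dom f"
      unfolding mem_conjugate_dom_iff by blast
    then show ?thesis
      unfolding p_def G_def by (rule min_slope_inner_nonneg)
  qed
  have A0: "A 0 = 0" and \<delta>: "\<And>k. 0 < fdiff A k"
    and \<delta>_le: "\<And>k. fdiff A k \<le> 2 * sqrt (A (Suc k) / L)"
    using assms(3) by (auto simp: step_size_condition_def)
  have A_Suc: "A (Suc k) = A k + fdiff A k" for k
    by (simp add: fdiff_def)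
  have A_nonneg: "0 \<le> A k" for k
    by (induction k) (use A0 A_Suc \<delta> in \<open>auto simp: add_nonneg_nonneg less_imp_le\<close>)
  have A_pos: "0 < A (Suc k)" for k
    using A_Suc A_nonneg \<delta> by (simp add: add_nonneg_pos)
  have step: "L * (fdiff A k)\<^sup>2 / (4 * (A k + fdiff A k)) \<le> 1" for k
  proof -
    have "(fdiff A k)\<^sup>2 \<le> (2 * sqrt (A (Suc k) / L))\<^sup>2"
      using \<delta>[of k] \<delta>_le[of k] by (intro power_mono) auto
    also have "\<dots> = 4 * (A (Suc k) / L)"
      using A_pos[of k] assms(1) by (simp add: power_mult_distrib)
    finally show ?thesis
      using A_pos[of k] assms(1) by (simp add: A_Suc[symmetric] field_simps)
  qed
  have x_Suc: "x (Suc k) = y k - ((fdiff A k)\<^sup>2 / (4 * A (Suc k))) *\<^sub>R gradient f (y k)" for k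
    by (simp add: x_def y_def agm_iterate_def Let_def)
  have y_Suc: "y (Suc k) = x (Suc k)
      + ((A k * fdiff A (Suc k)) / (A (Suc (Suc k)) * fdiff A k)) *\<^sub>R (x (Suc k) - x k)" for k
    by (simp add: x_def y_def agm_iterate_def Let_def)
  have yz: "(A k + fdiff A k) *\<^sub>R y k = A k *\<^sub>R x k + fdiff A k *\<^sub>R z k" for k
  proof -
    have "fdiff A k *\<^sub>R z k = fdiff A k *\<^sub>R x k + A (Suc k) *\<^sub>R (y k - x k)"
      using \<delta>[of k] by (simp add: z_def scaleR_add_right)
    then show ?thesis by (simp add: A_Suc algebra_simps)
  qed
  have z_Suc: "z (Suc k) = z k - (fdiff A k / 4) *\<^sub>R gradient f (y k)" for k
  proof -
    let ?d = "fdiff A k"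
    \<comment> \<open>The extrapolation coefficient is tuned so that the factor
      \<open>A (Suc (Suc k)) / fdiff A (Suc k)\<close> from \<open>z\<close> cancels, leaving
      \<open>A k / ?d\<close>.\<close>
    have "z (Suc k) = x (Suc k) + (A k / ?d) *\<^sub>R (x (Suc k) - x k)"
      using \<delta>[of "Suc k"] A_pos[of "Suc k"] by (simp add: z_def y_Suc)
    also have "\<dots> = (1 + A k / ?d) *\<^sub>R (x (Suc k) - x k) + x k"
      by (simp add: algebra_simps)
    also have "1 + A k / ?d = A (Suc k) / ?d"
      using \<delta>[of k] by (simp add: A_Suc field_simps)
    also have "(A (Suc k) / ?d) *\<^sub>R (x (Suc k) - x k) + x k
        = z k - (A (Suc k) / ?d * (?d\<^sup>2 / (4 * A (Suc k)))) *\<^sub>R gradient f (y k)"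
      by (simp add: z_def x_Suc scaleR_diff_right)
    also have "A (Suc k) / ?d * (?d\<^sup>2 / (4 * A (Suc k))) = ?d / 4"
      using \<delta>[of k] A_pos[of k] by (simp add: power2_eq_square)
    finally show ?thesis .
  qed
  have z0: "z 0 = x0"
    by (simp add: z_def x_def y_def agm_iterate_def)
  have energy: "A k * (g (x k) - g w) + 2 * (norm (z k - (w - (A k / 4) *\<^sub>R p)))\<^sup>2
      \<le> 2 * (norm (w - x0))\<^sup>2" for k w
  proof (induction k)
    case 0
    \<comment> \<open>At index 0, \<open>A 0 = 0\<close> removes both the function gap and the shift
      of the comparison point.\<close>
    show ?case by (simp add: A0 z0 norm_minus_commute)
  next
    case (Suc k)
    have "x (Suc k) = y k - ((fdiff A k)\<^sup>2 / (4 * (A k + fdiff A k))) *\<^sub>R (G (y k) + p)"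
      "z (Suc k) = z k - (fdiff A k / 4) *\<^sub>R (G (y k) + p)"
      by (simp_all add: G_def x_Suc z_Suc A_Suc)
    from lyapunov_step[OF tangent smooth drift A_nonneg \<delta> step yz this, of w] Suc
    show ?case by (simp add: A_Suc)
  qed
  have bound: "g (x k) \<le> g w + 2 * (norm (w - x0))\<^sup>2 / A k" if "k \<ge> 1" for k w
  proof -
    have "0 < A k"
      using A_pos[of "k - 1"] that by simp
    moreover have "A k * (g (x k) - g w) \<le> 2 * (norm (w - x0))\<^sup>2"
      using energy[of k w] zero_le_power2[of "norm (z k - (w - (A k / 4) *\<^sub>R p))"] by linarith
    ultimately show ?thesis
      by (simp add: field_simps)
  qed
  have "(\<lambda>k. ereal (g (x k))) \<longlonglongrightarrow> (INF a. ereal (g a))"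
  \<comment> \<open>Comparing with thresholds \<open>c\<close> treats finite and infinite infima
    alike: each \<open>c\<close> above the infimum exceeds some \<open>g w\<close>, and
    \<open>bound\<close> for this fixed \<open>w\<close> has a right-hand side tending to
    \<open>g w\<close>.\<close>
  proof (rule order_tendstoI)
    fix c assume "c < (INF a. ereal (g a))"
    then have "c < ereal (g (x k))" for k
      by (rule less_le_trans) (rule INF_lower, simp)
    then show "eventually (\<lambda>k. c < ereal (g (x k))) sequentially" by simp
  next
    fix c assume "(INF a. ereal (g a)) < c"
    then obtain w where w: "ereal (g w) < c"
      by (auto simp: INF_less_iff)
    have "(\<lambda>k. g w + 2 * (norm (w - x0))\<^sup>2 / A k) \<longlonglongrightarrow> g w + 0"
      by (intro tendsto_intros tendsto_divide_0[OF tendsto_const] filterlim_at_top_imp_at_infinity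
          step_size_tendsto_at_top[OF assms(3)])
    then have "(\<lambda>k. ereal (g w + 2 * (norm (w - x0))\<^sup>2 / A k)) \<longlonglongrightarrow> ereal (g w)"
      by simp
    from order_tendstoD(2)[OF this w] eventually_ge_at_top[of 1]
    show "eventually (\<lambda>k. ereal (g (x k)) < c) sequentially"
      by eventually_elim (meson bound ereal_less_eq(3) le_less_trans)
  qed
  with bound show ?thesis
    by (simp add: g_def x_def)
qed

end
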